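(* Let $C_n$ denote the cycle graph on $n$ vertices. For every integer $n > 3$, $$\varepsilon(C_n) = \frac{1}{n}\left( \frac{1}{\cos(\frac{\pi}{n})} - 1\right).$$
   Context: For a finite simple undirected graph $G$ with vertex set $[n]$, $\mathrm{Sym}(G)=\mathbb{R}^{V(G)+E(G)}$ is the space of partially specified symmetric $n\times n$ real matrices: $A\in\mathrm{Sym}(G)$ specifies the diagonal entries $A_{ii}$ and the entries $A_{ij}=A_{ji}$ for $\{i,j\}\in E(G)$, the others being unspecified. $\mathrm{tr}(A)=\sum_i A_{ii}$, and $I_n$ also denotes the image of the identity matrix in $\mathrm{Sym}(G)$ (diagonal entries $1$, edge entries $0$). $\Sigma(G)$ is the set of $A\in\mathrm{Sym}(G)$ for which there is a real symmetric positive semidefinite (PSD) $n\times n$ matrix agreeing with $A$ on all specified entries. $\mathcal{P}(G)$ is the set of $A\in \mathrm{Sym}(G)$ such that for every maximal clique $K$ of $G$ the (fully specified) principal submatrix of $A$ indexed by $K$ is PSD. $\bar{\mathcal{P}}(G)=\{A\in\mathcal{P}(G):\mathrm{tr}(A)=1\}$. The conical distance $\varepsilon(G)$ is the smallest real $\varepsilon$ such that $M+\varepsilon I_n\in\Sigma(G)$ for all $M\in\bar{\mathcal{P}}(G)$. *)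

theory Defs
  imports "HOL-Analysis.Analysis"
begin

type_synonym 'a graph = "'a set \<times> 'a set set"

abbreviation verts :: "'a graph \<Rightarrow> 'a set" where
  "verts \<equiv> fst"

abbreviation edges :: "'a graph \<Rightarrow> 'a set set" where
  "edges \<equiv> snd"

definition simple_graph :: "'a graph \<Rightarrow> bool" where
  "simple_graph G \<longleftrightarrow> finite (verts G) \<and> (\<forall>e\<in>edges G. e \<subseteq> verts G \<and> card e = 2)"

definition clique :: "'a graph \<Rightarrow> 'a set \<Rightarrow> bool" where
  "clique G K \<longleftrightarrow> K \<subseteq> verts G \<and> (\<forall>i\<in>K. \<forall>j\<in>K. i \<noteq> j \<longrightarrow> {i, j} \<in> edges G)"

definition maximal_clique :: "'a graph \<Rightarrow> 'a set \<Rightarrow> bool" where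
  "maximal_clique G K \<longleftrightarrow> clique G K \<and> (\<forall>L. clique G L \<and> K \<subseteq> L \<longrightarrow> L = K)"

text \<open>
  A real square matrix with rows and columns indexed by a finite set \<open>K\<close> is a binary function
  of which only the values on \<open>K \<times> K\<close> matter; its principal submatrices are obtained by
  shrinking \<open>K\<close>.
\<close>

definition psd_on :: "'a set \<Rightarrow> ('a \<Rightarrow> 'a \<Rightarrow> real) \<Rightarrow> bool" where
  "psd_on K X \<longleftrightarrow>
     (\<forall>i\<in>K. \<forall>j\<in>K. X i j = X j i) \<and>
     (\<forall>x :: 'a \<Rightarrow> real. 0 \<le> (\<Sum>i\<in>K. \<Sum>j\<in>K. x i * X i j * x j))"

text \<open>
  Partially specified symmetric matrices: real vectors with coordinates in the disjoint union
  of the vertices (diagonal entries) and the edges (off-diagonal entries).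
\<close>

definition coords :: "'a graph \<Rightarrow> ('a + 'a set) set" where
  "coords G = verts G <+> edges G"

definition Sym :: "'a graph \<Rightarrow> ('a + 'a set \<Rightarrow> real) set" where
  "Sym G = coords G \<rightarrow>\<^sub>E UNIV"

definition entry :: "('a + 'a set \<Rightarrow> real) \<Rightarrow> 'a \<Rightarrow> 'a \<Rightarrow> real" where
  "entry A i j = (if i = j then A (Inl i) else A (Inr {i, j}))"

definition sym_trace :: "'a graph \<Rightarrow> ('a + 'a set \<Rightarrow> real) \<Rightarrow> real" where
  "sym_trace G A = (\<Sum>i\<in>verts G. entry A i i)"

definition sym_id :: "'a graph \<Rightarrow> 'a + 'a set \<Rightarrow> real" where
  "sym_id G = (\<lambda>s\<in>coords G. case s of Inl i \<Rightarrow> 1 | Inr e \<Rightarrow> 0)"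

definition sym_add ::
  "'a graph \<Rightarrow> ('a + 'a set \<Rightarrow> real) \<Rightarrow> ('a + 'a set \<Rightarrow> real) \<Rightarrow> 'a + 'a set \<Rightarrow> real" where
  "sym_add G A B = (\<lambda>s\<in>coords G. A s + B s)"

definition sym_scale ::
  "'a graph \<Rightarrow> real \<Rightarrow> ('a + 'a set \<Rightarrow> real) \<Rightarrow> 'a + 'a set \<Rightarrow> real" where
  "sym_scale G c A = (\<lambda>s\<in>coords G. c * A s)"

definition psd_completable :: "'a graph \<Rightarrow> ('a + 'a set \<Rightarrow> real) set" where
  "psd_completable G =
     {A \<in> Sym G. \<exists>X. psd_on (verts G) X \<and>
        (\<forall>i\<in>verts G. \<forall>j\<in>verts G. i = j \<or> {i, j} \<in> edges G \<longrightarrow> X i j = entry A i j)}"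

definition clique_psd :: "'a graph \<Rightarrow> ('a + 'a set \<Rightarrow> real) set" where
  "clique_psd G = {A \<in> Sym G. \<forall>K. maximal_clique G K \<longrightarrow> psd_on K (entry A)}"

definition clique_psd_normalized :: "'a graph \<Rightarrow> ('a + 'a set \<Rightarrow> real) set" where
  "clique_psd_normalized G = {A \<in> clique_psd G. sym_trace G A = 1}"

definition conical_distance :: "'a graph \<Rightarrow> real" where
  "conical_distance G =
     (LEAST \<epsilon>. \<forall>M\<in>clique_psd_normalized G.
        sym_add G M (sym_scale G \<epsilon> (sym_id G)) \<in> psd_completable G)"

definition cycle_graph :: "nat \<Rightarrow> nat graph" where
  "cycle_graph n = ({1..n}, {{i, i mod n + 1} | i. i \<in> {1..n}})"

lemma simple_graph_cycle_graph:
  assumes "n \<ge> 3"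
  shows "simple_graph (cycle_graph n)"
proof -
  have "{i, i mod n + 1} \<subseteq> {1..n} \<and> card {i, i mod n + 1} = 2" if i: "i \<in> {1..n}" for i
  proof (cases "i = n")
    case True
    then show ?thesis using assms by auto
  next
    case False
    then have "i mod n = i" using i by auto
    then show ?thesis using i False by auto
  qed
  then show ?thesis
    unfolding simple_graph_def cycle_graph_def by auto
qed

end

theory Submission
  imports Defs
begin

text \<open>
  Upper bound. Put \<open>x\<^sub>i = \<surd>M\<^sub>i\<^sub>i\<close>. Completability is convex in the edge entries, so these may be assumed
  to be \<open>\<plusminus> x\<^sub>i x\<^sub>i\<^sub>+\<^sub>1\<close>. If the product of the signs is \<open>+1\<close>, then \<open>M\<close> has a completion of rank one. If it is
  \<open>-1\<close>, let \<open>\<phi>\<^sub>i(e) = arccos (x\<^sub>i x\<^sub>i\<^sub>+\<^sub>1 / \<surd>((x\<^sub>i\<^sup>2 + e) (x\<^sub>i\<^sub>+\<^sub>1\<^sup>2 + e)))\<close>. When \<open>\<Sum>\<^sub>i \<phi>\<^sub>i(e) = \<pi>\<close>, vectors in the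
  plane with consecutive angles \<open>\<phi>\<^sub>i(e)\<close> give a completion of \<open>M + e I\<close>; as the sum vanishes at \<open>e = 0\<close>
  (unless some \<open>x\<^sub>k = 0\<close>, and then the sign of the \<open>k\<close>-th edge is immaterial), it suffices that it is at least \<open>\<pi>\<close> for the claimed value \<open>\<epsilon>\<close> of \<open>e\<close>. Now
  \<open>cos A cos B \<le> cos\<^sup>2 ((A + B) / 2)\<close> bounds the sum from below by \<open>\<Sum>\<^sub>i F (x\<^sub>i\<^sup>2)\<close> with
  \<open>F p = arccos (p / (p + \<epsilon>))\<close>, and \<open>F\<close> is convex, so Jensen's inequality gives
  \<open>\<Sum>\<^sub>i F (x\<^sub>i\<^sup>2) \<ge> n F (1 / n) = \<pi>\<close>.

  Lower bound. The extremal \<open>M\<close> has all entries \<open>1 / n\<close> except for one edge entry \<open>- 1 / n\<close>. The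
  certificate is the positive semidefinite matrix \<open>2 cos (\<pi> / n) I - A\<close>, where \<open>A\<close> is the adjacency
  matrix of the cycle with the sign of that edge reversed.
\<close>

subsection \<open>Positive semidefinite matrices\<close>

lemma psd_on_sym: "psd_on K X \<Longrightarrow> i \<in> K \<Longrightarrow> j \<in> K \<Longrightarrow> X i j = X j i"
  unfolding psd_on_def by blast

lemma psd_on_nonneg: "psd_on K X \<Longrightarrow> 0 \<le> (\<Sum>i\<in>K. \<Sum>j\<in>K. x i * X i j * x j)"
  unfolding psd_on_def by blast

lemma psd_on_subset:
  assumes "psd_on K X" "L \<subseteq> K" "finite K"
  shows "psd_on L X"
  unfolding psd_on_def
proof (intro conjI allI)
  show "\<forall>i\<in>L. \<forall>j\<in>L. X i j = X j i" using assms unfolding psd_on_def by blast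
  fix x :: "'a \<Rightarrow> real"
  let ?y = "\<lambda>i. if i \<in> L then x i else 0"
  have "0 \<le> (\<Sum>i\<in>K. \<Sum>j\<in>K. ?y i * X i j * ?y j)"
    using psd_on_nonneg[OF assms(1)] .
  also have "\<dots> = (\<Sum>i\<in>L. \<Sum>j\<in>K. ?y i * X i j * ?y j)"
    using assms(2,3) by (intro sum.mono_neutral_right) auto
  also have "\<dots> = (\<Sum>i\<in>L. \<Sum>j\<in>L. ?y i * X i j * ?y j)"
    using assms(2,3) by (intro sum.cong sum.mono_neutral_right) auto
  also have "\<dots> = (\<Sum>i\<in>L. \<Sum>j\<in>L. x i * X i j * x j)"
    by (intro sum.cong) auto
  finally show "0 \<le> (\<Sum>i\<in>L. \<Sum>j\<in>L. x i * X i j * x j)" .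
qed

lemma psd_on_cong:
  assumes "\<And>i j. i \<in> K \<Longrightarrow> j \<in> K \<Longrightarrow> X i j = Y i j"
  shows "psd_on K X \<longleftrightarrow> psd_on K Y"
  using assms unfolding psd_on_def by simp

lemma psd_on_gram: "psd_on K (\<lambda>i j. u i * u j)"
  unfolding psd_on_def
proof (intro conjI allI)
  fix x :: "'a \<Rightarrow> real"
  have "(\<Sum>i\<in>K. \<Sum>j\<in>K. x i * (u i * u j) * x j) = (\<Sum>i\<in>K. x i * u i) * (\<Sum>j\<in>K. x j * u j)"
    by (simp add: sum_product algebra_simps)
  then show "0 \<le> (\<Sum>i\<in>K. \<Sum>j\<in>K. x i * (u i * u j) * x j)" by simp
qed simp

lemma psd_on_add:
  assumes "psd_on K X" "psd_on K Y"
  shows "psd_on K (\<lambda>i j. X i j + Y i j)"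
  using assms unfolding psd_on_def
  by (simp add: distrib_left distrib_right sum.distrib)

lemma psd_on_scale:
  assumes "psd_on K X" "c \<ge> 0"
  shows "psd_on K (\<lambda>i j. c * X i j)"
  unfolding psd_on_def
proof (intro conjI allI)
  show "\<forall>i\<in>K. \<forall>j\<in>K. c * X i j = c * X j i"
    using assms unfolding psd_on_def by simp
  fix x :: "'a \<Rightarrow> real"
  have "(\<Sum>i\<in>K. \<Sum>j\<in>K. x i * (c * X i j) * x j) = c * (\<Sum>i\<in>K. \<Sum>j\<in>K. x i * X i j * x j)"
    by (simp add: sum_distrib_left algebra_simps)
  then show "0 \<le> (\<Sum>i\<in>K. \<Sum>j\<in>K. x i * (c * X i j) * x j)"
    using assms unfolding psd_on_def by simp
qed

lemma psd_on_diag: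
  assumes "c \<ge> 0" "finite K"
  shows "psd_on K (\<lambda>i j. if i = j then c else 0)"
  unfolding psd_on_def
proof (intro conjI allI)
  fix x :: "'a \<Rightarrow> real"
  have "(\<Sum>i\<in>K. \<Sum>j\<in>K. x i * (if i = j then c else 0) * x j) = (\<Sum>i\<in>K. \<Sum>j\<in>K. if i = j then x i * c * x i else 0)"
    by (intro sum.cong) auto
  also have "\<dots> = (\<Sum>i\<in>K. c * (x i)\<^sup>2)"
    using assms by (simp add: power2_eq_square algebra_simps)
  also have "\<dots> \<ge> 0" using assms by (intro sum_nonneg) auto
  finally show "0 \<le> (\<Sum>i\<in>K. \<Sum>j\<in>K. x i * (if i = j then c else 0) * x j)" .
qed simp

text \<open>The form at \<open>(X j j, - X i j)\<close> gives the determinant inequality. With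
  square roots it reads \<open>\<bar>b i\<bar> \<le> x i * x (cyc_next n i)\<close>, the box that
  \<open>cycle_completable_box\<close> works in.\<close>

lemma psd_on_pair:
  assumes "psd_on {i, j} X" "i \<noteq> j"
  shows "X i i \<ge> 0" "X j j \<ge> 0" "\<bar>X i j\<bar> \<le> sqrt (X i i) * sqrt (X j j)"
proof -
  have q: "0 \<le> s\<^sup>2 * X i i + 2 * s * t * X i j + t\<^sup>2 * X j j" for s t
  proof -
    have "0 \<le> (\<Sum>k\<in>{i,j}. \<Sum>l\<in>{i,j}. (if k = i then s else t) * X k l * (if l = i then s else t))"
      using psd_on_nonneg[OF assms(1)] .
    also have "\<dots> = s\<^sup>2 * X i i + 2 * s * t * X i j + t\<^sup>2 * X j j"
      using assms(2) psd_on_sym[OF assms(1), of i j] by (simp add: power2_eq_square algebra_simps)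
    finally show ?thesis .
  qed
  show i: "X i i \<ge> 0" and j: "X j j \<ge> 0" using q[of 1 0] q[of 0 1] by auto
  have "(X i j)\<^sup>2 \<le> X i i * X j j"
  proof (cases "X j j = 0")
    case True
    \<comment> \<open>When \<open>X j j = 0\<close> the form is affine in the second coordinate. If
      \<open>X i j\<close> were nonzero, this coordinate would give the form the value -1.\<close>
    have "0 \<le> X i i - 2 * ((X i i + 1) / 2 / X i j) * X i j"
      using q[of 1 "- ((X i i + 1) / 2 / X i j)"] True by simp
    then have "X i j = 0" using i by (cases "X i j = 0") (auto simp: field_simps)
    then show ?thesis using True by simp
  next
    case False
    then have "X j j > 0" using j by simp
    moreover have "0 \<le> X j j * (X i i * X j j - (X i j)\<^sup>2)"
      using q[of "X j j" "- X i j"] by (simp add: power2_eq_square algebra_simps)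
    ultimately show ?thesis by (simp add: zero_le_mult_iff)
  qed
  then show "\<bar>X i j\<bar> \<le> sqrt (X i i) * sqrt (X j j)"
    by (metis real_sqrt_abs real_sqrt_le_iff real_sqrt_mult)
qed

text \<open>Serves the triangles \<open>{n, i, Suc i}\<close> that triangulate the cycle in the
  lower bound.\<close>

lemma psd_on_triple:
  assumes "psd_on {i, j, k} X" "i \<noteq> j" "i \<noteq> k" "j \<noteq> k"
  shows "0 \<le> a\<^sup>2 * X i i + b\<^sup>2 * X j j + c\<^sup>2 * X k k
    + 2 * a * b * X i j + 2 * a * c * X i k + 2 * b * c * X j k"
proof -
  let ?v = "\<lambda>l. if l = i then a else if l = j then b else c"
  have "0 \<le> (\<Sum>l\<in>{i,j,k}. \<Sum>m\<in>{i,j,k}. ?v l * X l m * ?v m)"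
    using psd_on_nonneg[OF assms(1)] .
  also have "\<dots> = a\<^sup>2 * X i i + b\<^sup>2 * X j j + c\<^sup>2 * X k k
    + 2 * a * b * X i j + 2 * a * c * X i k + 2 * b * c * X j k"
    using assms(2-4) psd_on_sym[OF assms(1), of i j] psd_on_sym[OF assms(1), of i k]
      psd_on_sym[OF assms(1), of j k]
    by (simp add: power2_eq_square algebra_simps)
  finally show ?thesis .
qed

subsection \<open>Cycles\<close>

definition cyc_next :: "nat \<Rightarrow> nat \<Rightarrow> nat" where
  "cyc_next n i = i mod n + 1"

lemma cyc_next_eq: "i \<in> {1..n} \<Longrightarrow> cyc_next n i = (if i = n then 1 else i + 1)"
  by (auto simp: cyc_next_def)

lemma cyc_next_in: "i \<in> {1..n} \<Longrightarrow> cyc_next n i \<in> {1..n}"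
  by (auto simp: cyc_next_eq)

lemma bij_betw_cyc_next: "bij_betw (cyc_next n) {1..n} {1..n}"
proof -
  have inj: "inj_on (cyc_next n) {1..n}"
  proof (rule inj_onI)
    fix i j assume i: "i \<in> {1..n}" and j: "j \<in> {1..n}" and "cyc_next n i = cyc_next n j"
    then have "(if i = n then 1 else i + 1) = (if j = n then 1 else j + 1)"
      by (simp only: cyc_next_eq[OF i] cyc_next_eq[OF j])
    then show "i = j" using i j by (cases "i = n"; cases "j = n") auto
  qed
  have "cyc_next n ` {1..n} = {1..n}"
    by (intro endo_inj_surj image_subsetI cyc_next_in inj) simp
  with inj show ?thesis unfolding bij_betw_def by blast
qed

lemma cycle_edge_iff:
  assumes "n > 2" "i \<in> {1..n}" "j \<in> {1..n}"
  shows "{i, j} \<in> edges (cycle_graph n) \<longleftrightarrow> j = cyc_next n i \<or> i = cyc_next n j"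
  using assms unfolding cycle_graph_def cyc_next_def[symmetric] by (auto simp: doubleton_eq_iff)

text \<open>A third vertex of the clique would form a triangle with the edge, and a cycle of length
  greater than 3 has none.\<close>

lemma cycle_clique_subset_edge:
  assumes "n > 3" "clique (cycle_graph n) K" "i \<in> {1..n}" "{i, cyc_next n i} \<subseteq> K"
  shows "K = {i, cyc_next n i}"
proof (rule ccontr)
  assume "K \<noteq> {i, cyc_next n i}"
  then obtain k where k: "k \<in> K" "k \<noteq> i" "k \<noteq> cyc_next n i" using assms(4) by blast
  have K: "K \<subseteq> {1..n}" using assms(2) unfolding clique_def cycle_graph_def by simp
  have "{k, i} \<in> edges (cycle_graph n)" "{k, cyc_next n i} \<in> edges (cycle_graph n)"
    using assms(2,4) k unfolding clique_def by auto
  moreover have "k \<in> {1..n}" using k K by blast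
  ultimately show False
    using assms(1,3) k cyc_next_in[OF assms(3)]
    by (auto simp: cycle_edge_iff cyc_next_eq split: if_splits)
qed

lemma cycle_edge_maximal_clique:
  assumes "n > 3" "i \<in> {1..n}"
  shows "maximal_clique (cycle_graph n) {i, cyc_next n i}"
  unfolding maximal_clique_def
proof (intro conjI allI impI)
  show "clique (cycle_graph n) {i, cyc_next n i}"
    using assms cyc_next_in[OF assms(2)] unfolding clique_def cycle_graph_def cyc_next_def[symmetric]
    by (auto simp: insert_commute)
qed (use assms cycle_clique_subset_edge in blast)

lemma cycle_clique_cases:
  assumes "n > 3" "clique (cycle_graph n) K"
  shows "\<exists>i\<in>{1..n}. K \<subseteq> {i, cyc_next n i}"
proof (cases "\<exists>i\<in>K. \<exists>j\<in>K. i \<noteq> j")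
  case True
  then obtain i j where ij: "i \<in> K" "j \<in> K" "i \<noteq> j" by blast
  have K: "K \<subseteq> {1..n}" using assms(2) unfolding clique_def cycle_graph_def by simp
  have "{i, j} \<in> edges (cycle_graph n)" using assms(2) ij unfolding clique_def by blast
  then have "j = cyc_next n i \<or> i = cyc_next n j"
    using cycle_edge_iff[of n i j] assms(1) ij K subsetD[OF K] by simp
  then show ?thesis
  proof
    assume "j = cyc_next n i"
    then have "K = {i, cyc_next n i}"
      using cycle_clique_subset_edge[OF assms, of i] ij K by blast
    then show ?thesis using ij(1) K by blast
  next
    assume "i = cyc_next n j"
    then have "K = {j, cyc_next n j}"
      using cycle_clique_subset_edge[OF assms, of j] ij K by blast
    then show ?thesis using ij(2) K by blast
  qed
next
  case False
  have K: "K \<subseteq> {1..n}" using assms(2) unfolding clique_def cycle_graph_def by simp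
  show ?thesis
  proof (cases "K = {}")
    case True
    then show ?thesis using assms(1) by (intro bexI[of _ 1]) auto
  next
    case F: False
    then obtain i where "i \<in> K" by blast
    then have "K = {i}" using False by blast
    then show ?thesis using K by blast
  qed
qed

section \<open>Completability of cycle data: convexity in the edge entries and planar Gram
  matrices\<close>

definition cycle_completable :: "nat \<Rightarrow> (nat \<Rightarrow> real) \<Rightarrow> (nat \<Rightarrow> real) \<Rightarrow> bool" where
  "cycle_completable n d b \<longleftrightarrow>
     (\<exists>X. psd_on {1..n} X \<and> (\<forall>i\<in>{1..n}. X i i = d i \<and> X i (cyc_next n i) = b i))"

lemma psd_completable_cycle_iff:
  assumes "n > 2" "A \<in> Sym (cycle_graph n)"
  shows "A \<in> psd_completable (cycle_graph n) \<longleftrightarrow>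
    cycle_completable n (\<lambda>i. A (Inl i)) (\<lambda>i. A (Inr {i, cyc_next n i}))"
proof -
  have "(\<forall>i\<in>{1..n}. \<forall>j\<in>{1..n}. i = j \<or> {i, j} \<in> edges (cycle_graph n) \<longrightarrow> X i j = entry A i j) \<longleftrightarrow>
    (\<forall>i\<in>{1..n}. X i i = A (Inl i) \<and> X i (cyc_next n i) = A (Inr {i, cyc_next n i}))" (is "?L \<longleftrightarrow> ?R")
    if X: "psd_on {1..n} X" for X
  proof
    assume L: ?L
    show ?R
    proof (intro ballI conjI)
      fix i assume i: "i \<in> {1..n}"
      show "X i i = A (Inl i)" using L i by (auto simp: entry_def)
      have "i \<noteq> cyc_next n i" using i assms(1) by (auto simp: cyc_next_eq)
      moreover have "{i, cyc_next n i} \<in> edges (cycle_graph n)"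
        using i unfolding cycle_graph_def cyc_next_def by auto
      ultimately show "X i (cyc_next n i) = A (Inr {i, cyc_next n i})"
        using L i cyc_next_in[OF i] unfolding entry_def by metis
    qed
  next
    assume R: ?R
    show ?L
    proof (intro ballI impI)
      fix i j assume ij: "i \<in> {1..n}" "j \<in> {1..n}" "i = j \<or> {i, j} \<in> edges (cycle_graph n)"
      show "X i j = entry A i j"
      proof (cases "i = j")
        case True
        then show ?thesis using R ij by (auto simp: entry_def)
      next
        case False
        then consider "j = cyc_next n i" | "i = cyc_next n j"
          using cycle_edge_iff[OF assms(1) ij(1,2)] ij(3) by blast
        then show ?thesis
        proof cases
          case 1
          then show ?thesis using R ij False unfolding entry_def by simp
        next
          case 2
          then have "X j i = A (Inr {j, i})" using R ij by blast
          then show ?thesis using False psd_on_sym[OF X ij(1,2)]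
            unfolding entry_def by (simp add: insert_commute)
        qed
      qed
    qed
  qed
  moreover have "verts (cycle_graph n) = {1..n}" unfolding cycle_graph_def by simp
  ultimately show ?thesis
    using assms(2) unfolding psd_completable_def cycle_completable_def by auto
qed

lemma cycle_completable_add_diag:
  assumes "cycle_completable n d b" "c \<ge> 0" "n > 1"
  shows "cycle_completable n (\<lambda>i. d i + c) b"
proof -
  obtain X where X: "psd_on {1..n} X" "\<forall>i\<in>{1..n}. X i i = d i \<and> X i (cyc_next n i) = b i"
    using assms(1) unfolding cycle_completable_def by blast
  have "i \<noteq> cyc_next n i" if "i \<in> {1..n}" for i
    using that assms(3) by (auto simp: cyc_next_eq)
  then show ?thesis
    unfolding cycle_completable_def using X assms(2)
    by (intro exI[of _ "\<lambda>i j. X i j + (if i = j then c else 0)"]) (auto intro!: psd_on_add psd_on_diag)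
qed

lemma cycle_completable_convex:
  assumes "cycle_completable n d b" "cycle_completable n d b'" "0 \<le> t" "t \<le> 1"
  shows "cycle_completable n d (\<lambda>i. t * b i + (1 - t) * b' i)"
proof -
  obtain X where X: "psd_on {1..n} X" "\<forall>i\<in>{1..n}. X i i = d i \<and> X i (cyc_next n i) = b i"
    using assms(1) unfolding cycle_completable_def by blast
  obtain Y where Y: "psd_on {1..n} Y" "\<forall>i\<in>{1..n}. Y i i = d i \<and> Y i (cyc_next n i) = b' i"
    using assms(2) unfolding cycle_completable_def by blast
  have "psd_on {1..n} (\<lambda>i j. t * X i j + (1 - t) * Y i j)"
    using X(1) Y(1) assms(3,4) by (intro psd_on_add psd_on_scale) auto
  moreover have "\<forall>i\<in>{1..n}. t * X i i + (1 - t) * Y i i = d i"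
    using X(2) Y(2) by (simp add: algebra_simps)
  ultimately show ?thesis
    unfolding cycle_completable_def using X(2) Y(2)
    by (intro exI[of _ "\<lambda>i j. t * X i j + (1 - t) * Y i j"]) auto
qed

lemma cycle_completable_cong:
  assumes "cycle_completable n d b"
    and "\<And>i. i \<in> {1..n} \<Longrightarrow> d i = d' i" "\<And>i. i \<in> {1..n} \<Longrightarrow> b i = b' i"
  shows "cycle_completable n d' b'"
proof -
  obtain X where "psd_on {1..n} X" "\<forall>i\<in>{1..n}. X i i = d i \<and> X i (cyc_next n i) = b i"
    using assms(1) unfolding cycle_completable_def by blast
  then show ?thesis
    unfolding cycle_completable_def using assms(2,3) by (intro exI[of _ X]) simp
qed

text \<open>A point of a box is a convex combination of its corners, and for a fixed diagonal
  completability is convex in the edge entries.\<close>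

lemma cycle_completable_box:
  assumes d: "\<And>b. (\<And>i. i \<in> {1..n} \<Longrightarrow> \<bar>b i\<bar> = B i) \<Longrightarrow> cycle_completable n d b"
    and b: "\<And>i. i \<in> {1..n} \<Longrightarrow> \<bar>b i\<bar> \<le> B i"
  shows "cycle_completable n d b"
proof -
  \<comment> \<open>\<open>S\<close> holds the edges whose entry may still lie inside its interval.
    The induction writes one such entry at a time as a combination of its two extreme
    values.\<close>
  have "cycle_completable n d b"
    if "S \<subseteq> {1..n}" "\<And>i. i \<in> {1..n} \<Longrightarrow> \<bar>b i\<bar> \<le> B i" "\<And>i. i \<in> {1..n} - S \<Longrightarrow> \<bar>b i\<bar> = B i" for S b
  proof -
    have "finite S" using that(1) finite_subset by blast
    then show ?thesis using that
    proof (induction S arbitrary: b)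
      case empty
      then show ?case using d by simp
    next
      case (insert k S)
      have step: "cycle_completable n d (b(k := c))" if "\<bar>c\<bar> = B k" for c
        using insert.prems that by (intro insert.IH) auto
      have k: "\<bar>b k\<bar> \<le> B k" using insert.prems by simp
      show ?case
      proof (cases "B k = 0")
        case True
        then have "\<bar>b k\<bar> = B k" using k by simp
        from step[OF this] show ?thesis by simp
      next
        case False
        then have B: "B k > 0" using k by simp
        define t where "t = (b k + B k) / (2 * B k)"
        have t: "0 \<le> t" "t \<le> 1" using B k by (auto simp: t_def field_simps)
        have "t * B k + (1 - t) * - B k = b k" using B by (simp add: t_def field_simps)
        then have "(\<lambda>i. t * (b(k := B k)) i + (1 - t) * (b(k := - B k)) i) = b"
          by (auto simp: fun_eq_iff algebra_simps)
        then show ?thesis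
          using cycle_completable_convex[OF step step t, of "B k" "- B k"] B by simp
      qed
    qed
  qed
  from this[of "{1..n}"] show ?thesis using b by auto
qed

text \<open>A planar Gram matrix: the \<open>i\<close>-th vector has length \<open>r i\<close> and, up to a sign chosen to absorb
  \<open>\<sigma>\<close>, direction \<open>\<phi> 1 + \<dots> + \<phi> (i - 1)\<close>.\<close>

lemma cycle_completable_planar:
  assumes "n > 0" and \<sigma>: "\<And>i. i \<in> {1..n} \<Longrightarrow> \<sigma> i * \<sigma> i = 1"
    and closing: "(\<Prod>i=1..n. \<sigma> i) * cos (\<Sum>i=1..<n. \<phi> i) = cos (\<phi> n)"
  shows "cycle_completable n (\<lambda>i. (r i)\<^sup>2) (\<lambda>i. \<sigma> i * (r i * r (cyc_next n i) * cos (\<phi> i)))"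
proof -
  define \<tau> where "\<tau> i = (\<Prod>k=1..<i. \<sigma> k)" for i
  define \<Theta> where "\<Theta> i = (\<Sum>k=1..<i. \<phi> k)" for i
  define X where "X i j = (\<tau> i * r i * cos (\<Theta> i)) * (\<tau> j * r j * cos (\<Theta> j))
    + (\<tau> i * r i * sin (\<Theta> i)) * (\<tau> j * r j * sin (\<Theta> j))" for i j
  have X: "X i j = \<tau> i * \<tau> j * r i * r j * cos (\<Theta> j - \<Theta> i)" for i j
    unfolding X_def cos_diff by (simp add: algebra_simps)
  have \<tau>2: "\<tau> i * \<tau> i = 1" if "i \<in> {1..n}" for i
    unfolding \<tau>_def prod.distrib[symmetric] using that \<sigma> by (intro prod.neutral) auto
  have psd: "psd_on {1..n} X"
    unfolding X_def by (intro psd_on_add psd_on_gram)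
  have "X i i = (r i)\<^sup>2 \<and> X i (cyc_next n i) = \<sigma> i * (r i * r (cyc_next n i) * cos (\<phi> i))"
    if i: "i \<in> {1..n}" for i
  proof
    show "X i i = (r i)\<^sup>2" using \<tau>2[OF i] by (simp add: X power2_eq_square)
    show "X i (cyc_next n i) = \<sigma> i * (r i * r (cyc_next n i) * cos (\<phi> i))"
    proof (cases "i = n")
      \<comment> \<open>The last edge returns to vertex 1, which has direction 0 and sign 1. Here
        \<open>closing\<close>, multiplied by \<open>\<sigma> n\<close>, is exactly the required
        identity.\<close>
      case True
      have "(\<Prod>i=1..n. \<sigma> i) = \<tau> n * \<sigma> n"
        unfolding \<tau>_def using assms(1) by (cases n) (auto simp: prod.atLeastLessThan_Suc atLeastLessThanSuc_atLeastAtMost[symmetric])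
      then have "\<tau> n * cos (\<Theta> n) = \<sigma> n * cos (\<phi> n)"
        using closing \<sigma>[of n] assms(1) unfolding \<Theta>_def
        by (metis (no_types, opaque_lifting) True i mult.assoc mult.commute mult.right_neutral)
      moreover have "\<tau> 1 = 1" "\<Theta> 1 = 0" by (auto simp: \<tau>_def \<Theta>_def)
      ultimately show ?thesis
        using True i by (simp add: X cyc_next_eq algebra_simps)
    next
      case False
      then have "i \<ge> 1" "cyc_next n i = Suc i" using i by (auto simp: cyc_next_eq)
      moreover from this have "\<tau> (Suc i) = \<tau> i * \<sigma> i" "\<Theta> (Suc i) = \<Theta> i + \<phi> i"
        by (auto simp: \<tau>_def \<Theta>_def)
      ultimately have "X i (cyc_next n i) = (\<tau> i * \<tau> i) * \<sigma> i * r i * r (cyc_next n i) * cos (\<phi> i)"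
        by (simp add: X)
      then show ?thesis using \<tau>2[OF i] by simp
    qed
  qed
  then show ?thesis unfolding cycle_completable_def using psd by blast
qed

text \<open>The angle between vectors of lengths \<open>sqrt (x\<^sup>2 + e)\<close> and
  \<open>sqrt (y\<^sup>2 + e)\<close> whose inner product is \<open>x * y\<close>.\<close>

definition edge_angle :: "real \<Rightarrow> real \<Rightarrow> real \<Rightarrow> real" where
  "edge_angle x y e = arccos (x * y / (sqrt (x\<^sup>2 + e) * sqrt (y\<^sup>2 + e)))"

lemma edge_cos_bounds:
  assumes "x \<ge> 0" "y \<ge> 0" "e \<ge> 0"
  shows "0 \<le> x * y / (sqrt (x\<^sup>2 + e) * sqrt (y\<^sup>2 + e))" "x * y / (sqrt (x\<^sup>2 + e) * sqrt (y\<^sup>2 + e)) \<le> 1"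
proof -
  have "x \<le> sqrt (x\<^sup>2 + e)" "y \<le> sqrt (y\<^sup>2 + e)" using assms by (auto intro: real_le_rsqrt)
  then have "x * y \<le> sqrt (x\<^sup>2 + e) * sqrt (y\<^sup>2 + e)" using assms by (intro mult_mono) auto
  then show "x * y / (sqrt (x\<^sup>2 + e) * sqrt (y\<^sup>2 + e)) \<le> 1"
    using assms by (intro divide_le_eq_1[THEN iffD2]) (auto simp: less_le)
qed (use assms in auto)

lemma cos_edge_angle:
  assumes "x \<ge> 0" "y \<ge> 0" "e \<ge> 0"
  shows "sqrt (x\<^sup>2 + e) * sqrt (y\<^sup>2 + e) * cos (edge_angle x y e) = x * y"
proof -
  have "cos (edge_angle x y e) = x * y / (sqrt (x\<^sup>2 + e) * sqrt (y\<^sup>2 + e))"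
    unfolding edge_angle_def using edge_cos_bounds[OF assms] by (intro cos_arccos) auto
  \<comment> \<open>If a length vanishes, the quotient is 0 by convention, and the identity survives
    because \<open>x * y\<close> vanishes as well.\<close>
  moreover have "x * y = 0" if "sqrt (x\<^sup>2 + e) * sqrt (y\<^sup>2 + e) = 0"
    using that assms by (auto simp: add_nonneg_eq_0_iff)
  ultimately show ?thesis by auto
qed

lemma continuous_on_edge_angle:
  assumes "x > 0" "y > 0"
  shows "continuous_on {0..E} (edge_angle x y)"
proof -
  have "x\<^sup>2 + e > 0" "y\<^sup>2 + e > 0" if "e \<in> {0..E}" for e
    using that assms by (auto intro: add_pos_nonneg)
  then have "x\<^sup>2 + e \<noteq> 0" "y\<^sup>2 + e \<noteq> 0" if "e \<in> {0..E}" for e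
    using that by fastforce+
  moreover have "-1 \<le> x * y / (sqrt (x\<^sup>2 + e) * sqrt (y\<^sup>2 + e))" 
    "x * y / (sqrt (x\<^sup>2 + e) * sqrt (y\<^sup>2 + e)) \<le> 1" if "e \<in> {0..E}" for e
    using edge_cos_bounds[of x y e] assms that by (auto intro: order_trans[of "-1" 0])
  ultimately show ?thesis
    unfolding edge_angle_def by (intro continuous_on_arccos continuous_intros ballI conjI) auto
qed

text \<open>With all angles zero the planar vectors are collinear, and the closing condition reduces
  to the sign product being 1.\<close>

lemma cycle_completable_even:
  assumes "n > 1" "\<And>i. i \<in> {1..n} \<Longrightarrow> \<sigma> i * \<sigma> i = (1::real)" "(\<Prod>i=1..n. \<sigma> i) = 1" "e \<ge> 0"
  shows "cycle_completable n (\<lambda>i. (x i)\<^sup>2 + e) (\<lambda>i. \<sigma> i * (x i * x (cyc_next n i)))"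
proof -
  have "cycle_completable n (\<lambda>i. (x i)\<^sup>2) (\<lambda>i. \<sigma> i * (x i * x (cyc_next n i) * cos 0))"
    using assms by (intro cycle_completable_planar) auto
  from cycle_completable_add_diag[OF this assms(4,1)] show ?thesis by simp
qed

lemma cycle_completable_odd:
  assumes "n > 1" and \<sigma>: "\<And>i. i \<in> {1..n} \<Longrightarrow> \<sigma> i * \<sigma> i = (1::real)" "(\<Prod>i=1..n. \<sigma> i) = -1"
    and x: "\<And>i. i \<in> {1..n} \<Longrightarrow> x i > 0" and "e \<ge> 0"
    and angles: "(\<Sum>i=1..n. edge_angle (x i) (x (cyc_next n i)) e) \<ge> pi"
  shows "cycle_completable n (\<lambda>i. (x i)\<^sup>2 + e) (\<lambda>i. \<sigma> i * (x i * x (cyc_next n i)))"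
proof -
  let ?F = "\<lambda>e. \<Sum>i=1..n. edge_angle (x i) (x (cyc_next n i)) e"
  have x': "x (cyc_next n i) > 0" if "i \<in> {1..n}" for i using x cyc_next_in that by blast
  \<comment> \<open>Positivity makes the quotient 1. With a zero entry it would be 0/0 = 0, giving
    the angle \<open>pi / 2\<close>.\<close>
  have "edge_angle (x i) (x (cyc_next n i)) 0 = 0" if "i \<in> {1..n}" for i
    using x[OF that] x'[OF that] by (simp add: edge_angle_def)
  then have "?F 0 = 0" by simp
  moreover have "continuous_on {0..e} ?F"
    using x x' by (intro continuous_on_sum continuous_on_edge_angle) auto
  ultimately obtain f where f: "0 \<le> f" "f \<le> e" "?F f = pi"
    using IVT'[of ?F 0 pi e] angles \<open>e \<ge> 0\<close> by auto
  define \<phi> where "\<phi> i = edge_angle (x i) (x (cyc_next n i)) f" for i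
  define r where "r i = sqrt ((x i)\<^sup>2 + f)" for i
  have "(\<Sum>i=1..n. \<phi> i) = (\<Sum>i=1..<n. \<phi> i) + \<phi> n"
    using assms(1) by (cases n) (auto simp: atLeastLessThanSuc_atLeastAtMost[symmetric])
  \<comment> \<open>The cosine of this angle is \<open>- cos (\<phi> n)\<close>, which compensates
    the sign product -1 in the closing condition.\<close>
  then have "(\<Sum>i=1..<n. \<phi> i) = pi - \<phi> n" using f(3) by (simp add: \<phi>_def)
  then have "cycle_completable n (\<lambda>i. (r i)\<^sup>2) (\<lambda>i. \<sigma> i * (r i * r (cyc_next n i) * cos (\<phi> i)))"
    using assms(1) \<sigma> by (intro cycle_completable_planar) auto
  moreover have "r i * r (cyc_next n i) * cos (\<phi> i) = x i * x (cyc_next n i)" if "i \<in> {1..n}" for i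
    unfolding r_def \<phi>_def using x[OF that] x'[OF that] f(1) by (intro cos_edge_angle) auto
  moreover have "(r i)\<^sup>2 = (x i)\<^sup>2 + f" for i using f(1) by (simp add: r_def)
  ultimately have "cycle_completable n (\<lambda>i. (x i)\<^sup>2 + f) (\<lambda>i. \<sigma> i * (x i * x (cyc_next n i)))"
    by (elim cycle_completable_cong) auto
  from cycle_completable_add_diag[OF this, of "e - f"] show ?thesis using f(2) assms(1) by simp
qed

lemma cycle_completable_of_angle_sum:
  assumes "n > 1" and x: "\<And>i. i \<in> {1..n} \<Longrightarrow> x i \<ge> 0" and "e \<ge> 0"
    and angles: "(\<Sum>i=1..n. edge_angle (x i) (x (cyc_next n i)) e) \<ge> pi"
    and b: "\<And>i. i \<in> {1..n} \<Longrightarrow> \<bar>b i\<bar> \<le> x i * x (cyc_next n i)"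
  shows "cycle_completable n (\<lambda>i. (x i)\<^sup>2 + e) b"
proof (rule cycle_completable_box[OF _ b])
  fix b assume b: "\<And>i. i \<in> {1..n} \<Longrightarrow> \<bar>b i\<bar> = x i * x (cyc_next n i)"
  \<comment> \<open>A zero entry gets the sign 1, not 0, so that every \<open>\<sigma> i\<close>
    squares to 1.\<close>
  define \<sigma> where "\<sigma> i = (if b i < 0 then - 1 else 1 :: real)" for i
  have \<sigma>: "\<sigma> i * \<sigma> i = 1" for i by (simp add: \<sigma>_def)
  have bs: "b i = \<sigma> i * (x i * x (cyc_next n i))" if "i \<in> {1..n}" for i
    using b[OF that] unfolding \<sigma>_def by (auto split: if_splits)
  have "(\<Prod>i=1..n. \<sigma> i) * (\<Prod>i=1..n. \<sigma> i) = 1"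
    unfolding prod.distrib[symmetric] by (simp add: \<sigma>)
  then have "(\<Prod>i=1..n. \<sigma> i) = 1 \<or> (\<Prod>i=1..n. \<sigma> i) = - 1" by (simp add: square_eq_1_iff)
  moreover have "(\<forall>i\<in>{1..n}. x i > 0) \<or> (\<exists>k\<in>{1..n}. x k = 0)"
    using x by (fastforce simp: order.order_iff_strict)
  ultimately consider "(\<Prod>i=1..n. \<sigma> i) = 1" | "(\<Prod>i=1..n. \<sigma> i) = - 1" "\<forall>i\<in>{1..n}. x i > 0"
    | k where "(\<Prod>i=1..n. \<sigma> i) = - 1" "k \<in> {1..n}" "x k = 0"
    by blast
  then have "cycle_completable n (\<lambda>i. (x i)\<^sup>2 + e) (\<lambda>i. \<sigma> i * (x i * x (cyc_next n i)))"
  proof cases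
    case 1
    then show ?thesis using assms(1,3) \<sigma> by (intro cycle_completable_even) auto
  next
    case 2
    then show ?thesis using assms(1,3) angles \<sigma> by (intro cycle_completable_odd) auto
  next
    case 3
    \<comment> \<open>The entry of the edge indexed by \<open>k\<close> is zero, so flipping its
      sign changes no entry but turns the sign product into 1.\<close>
    let ?\<sigma> = "\<sigma>(k := - \<sigma> k)"
    have "(\<Prod>i=1..n. ?\<sigma> i) = ?\<sigma> k * (\<Prod>i\<in>{1..n} - {k}. ?\<sigma> i)"
      using 3 by (intro prod.remove) auto
    also have "\<dots> = - (\<sigma> k * (\<Prod>i\<in>{1..n} - {k}. \<sigma> i))" by simp
    also have "\<sigma> k * (\<Prod>i\<in>{1..n} - {k}. \<sigma> i) = (\<Prod>i=1..n. \<sigma> i)"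
      using 3 by (intro prod.remove[symmetric]) auto
    finally have "cycle_completable n (\<lambda>i. (x i)\<^sup>2 + e) (\<lambda>i. ?\<sigma> i * (x i * x (cyc_next n i)))"
      using assms(1,3) 3 \<sigma> by (intro cycle_completable_even) auto
    moreover have "?\<sigma> i * (x i * x (cyc_next n i)) = \<sigma> i * (x i * x (cyc_next n i))" for i
      using 3 by auto
    ultimately show ?thesis by (simp only:)
  qed
  then show "cycle_completable n (\<lambda>i. (x i)\<^sup>2 + e) b"
    by (rule cycle_completable_cong) (use bs in auto)
qed

subsection \<open>The angle sum\<close>

lemma arccos_geometric_mean:
  fixes q r :: real
  assumes "0 \<le> q" "q \<le> 1" "0 \<le> r" "r \<le> 1"
  shows "(arccos q + arccos r) / 2 \<le> arccos (sqrt (q * r))"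
proof -
  define A B where "A = arccos q" and "B = arccos r"
  have AB: "0 \<le> A" "A \<le> pi/2" "0 \<le> B" "B \<le> pi/2" "cos A = q" "cos B = r"
    using assms arccos_le_pi2[of q] arccos_le_pi2[of r] by (auto simp: A_def B_def arccos_lbound)
  have "q * r = (cos (A - B) + cos (A + B)) / 2" using AB by (simp add: cos_times_cos flip: AB(5,6))
  also have "\<dots> \<le> (1 + cos (A + B)) / 2" by simp
  also have "\<dots> = (cos ((A + B) / 2))\<^sup>2" using cos_double_cos[of "(A + B) / 2"] by (simp add: add_divide_distrib)
  finally have "sqrt (q * r) \<le> sqrt ((cos ((A + B) / 2))\<^sup>2)" using real_sqrt_le_mono by blast
  \<comment> \<open>Both angles lie in [0, \<open>pi / 2\<close>], so the cosine of their mean is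
    nonnegative and equals the root of its square.\<close>
  also have "\<dots> = cos ((A + B) / 2)" using AB by (simp add: cos_ge_zero)
  finally have "arccos (cos ((A + B) / 2)) \<le> arccos (sqrt (q * r))"
    using assms by (intro arccos_le_arccos) (auto intro: order_trans[of "-1" 0])
  then show ?thesis using AB by (simp add: arccos_cos A_def B_def)
qed

text \<open>The derivative is \<open>- (e / ((p + e) * sqrt (e * (2 * p + e))))\<close>. Its
  denominator grows with \<open>p\<close>, so the derivative is increasing.\<close>

lemma convex_on_arccos_ratio:
  fixes e :: real
  assumes "e > 0"
  shows "convex_on {0..} (\<lambda>p. arccos (p / (p + e)))"
proof (rule convex_on_realI)
  fix p :: real assume "p \<in> {0..}"
  then have p: "p \<ge> 0" by simp
  define D S where "D = p + e" and "S = sqrt (e * (2 * p + e))"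
  have pos: "D > 0" "S > 0" using p assms by (auto simp: D_def S_def)
  have "D\<^sup>2 - p\<^sup>2 = e * (2 * p + e)" by (simp add: D_def power2_eq_square algebra_simps)
  moreover have "1 - (p / D)\<^sup>2 = (D\<^sup>2 - p\<^sup>2) / D\<^sup>2"
    using pos by (simp add: power_divide diff_divide_distrib)
  ultimately have s: "sqrt (1 - (p / D)\<^sup>2) = S / D"
    using pos by (simp add: real_sqrt_divide S_def)
  have "((\<lambda>p. p / (p + e)) has_real_derivative e / D\<^sup>2) (at p)"
    using pos(1) unfolding D_def by (auto intro!: derivative_eq_intros simp: power2_eq_square)
  moreover have "(arccos has_real_derivative inverse (- (S / D))) (at (p / (p + e)))"
    using DERIV_arccos[of "p / D"] p assms unfolding s by (auto simp: D_def field_simps)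
  ultimately have "((\<lambda>p. arccos (p / (p + e))) has_real_derivative inverse (- (S / D)) * (e / D\<^sup>2)) (at p)"
    by (intro DERIV_chain2)
  also have "inverse (- (S / D)) * (e / D\<^sup>2) = - (e / (D * S))"
    using pos by (simp add: power2_eq_square)
  finally show "((\<lambda>p. arccos (p / (p + e))) has_real_derivative
      - (e / ((p + e) * sqrt (e * (2 * p + e))))) (at p)"
    unfolding D_def S_def .
next
  fix p q :: real assume pq: "p \<in> {0..}" "q \<in> {0..}" "p \<le> q"
  then have "(p + e) * sqrt (e * (2 * p + e)) \<le> (q + e) * sqrt (e * (2 * q + e))"
    using assms by (intro mult_mono) auto
  moreover have "0 < (p + e) * sqrt (e * (2 * p + e))"
    using pq assms by (intro mult_pos_pos) auto
  ultimately show "- (e / ((p + e) * sqrt (e * (2 * p + e)))) \<le> - (e / ((q + e) * sqrt (e * (2 * q + e))))"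
    using assms by (simp add: frac_le)
qed (rule connected_Ici)

text \<open>Decouples the two endpoints of an edge, which turns the sum over edges into a sum over
  vertices.\<close>

lemma edge_angle_ge:
  assumes "x \<ge> 0" "y \<ge> 0" "e > 0"
  shows "(arccos (x\<^sup>2 / (x\<^sup>2 + e)) + arccos (y\<^sup>2 / (y\<^sup>2 + e))) / 2 \<le> edge_angle x y e"
proof -
  have "0 < x\<^sup>2 + e" "0 < y\<^sup>2 + e" using assms by (auto intro: add_nonneg_pos)
  then have "(arccos (x\<^sup>2 / (x\<^sup>2 + e)) + arccos (y\<^sup>2 / (y\<^sup>2 + e))) / 2
      \<le> arccos (sqrt (x\<^sup>2 / (x\<^sup>2 + e) * (y\<^sup>2 / (y\<^sup>2 + e))))"
    using assms by (intro arccos_geometric_mean) auto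
  also have "sqrt (x\<^sup>2 / (x\<^sup>2 + e) * (y\<^sup>2 / (y\<^sup>2 + e))) = x * y / (sqrt (x\<^sup>2 + e) * sqrt (y\<^sup>2 + e))"
    using assms by (simp add: real_sqrt_divide real_sqrt_mult)
  finally show ?thesis by (simp add: edge_angle_def)
qed

lemma edge_angle_sum_ge:
  assumes "n > 0" "e > 0" and x: "\<And>i. i \<in> {1..n} \<Longrightarrow> x i \<ge> 0"
    and sum: "(\<Sum>i=1..n. (x i)\<^sup>2) = 1"
  shows "real n * arccos (1 / (1 + real n * e)) \<le> (\<Sum>i=1..n. edge_angle (x i) (x (cyc_next n i)) e)"
proof -
  define F where "F p = arccos (p / (p + e))" for p
  have "F (\<Sum>i=1..n. (1 / real n) *\<^sub>R (x i)\<^sup>2) \<le> (\<Sum>i=1..n. (1 / real n) * F ((x i)\<^sup>2))"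
    using assms(1) convex_on_arccos_ratio[OF assms(2)]
    unfolding F_def by (intro convex_on_sum) auto
  also have "(\<Sum>i=1..n. (1 / real n) *\<^sub>R (x i)\<^sup>2) = 1 / real n"
    using sum by (simp flip: sum_divide_distrib)
  also have "(\<Sum>i=1..n. (1 / real n) * F ((x i)\<^sup>2)) = (\<Sum>i=1..n. F ((x i)\<^sup>2)) / real n"
    by (simp flip: sum_divide_distrib)
  also have "F (1 / real n) = arccos (1 / (1 + real n * e))"
    unfolding F_def using assms(1,2) by (simp add: field_simps)
  finally have "real n * arccos (1 / (1 + real n * e)) \<le> (\<Sum>i=1..n. F ((x i)\<^sup>2))"
    using assms(1) by (simp add: field_simps)
  \<comment> \<open>Each vertex starts one edge and ends another, and gives half of its value to
    each.\<close>
  also have "\<dots> = (\<Sum>i=1..n. (F ((x i)\<^sup>2) + F ((x (cyc_next n i))\<^sup>2)) / 2)"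
    using sum.reindex_bij_betw[OF bij_betw_cyc_next, of "\<lambda>i. F ((x i)\<^sup>2)" n]
    by (simp add: sum.distrib flip: sum_divide_distrib)
  also have "\<dots> \<le> (\<Sum>i=1..n. edge_angle (x i) (x (cyc_next n i)) e)"
    unfolding F_def using x cyc_next_in assms(2) by (intro sum_mono edge_angle_ge) auto
  finally show ?thesis .
qed

subsection \<open>The conical distance of a cycle\<close>

lemma cos_pi_over_nat:
  assumes "n > 2"
  shows "0 < cos (pi / real n)" "cos (pi / real n) < 1"
proof -
  have "pi / real n < pi / 2" using assms by (intro divide_strict_left_mono) auto
  then show "0 < cos (pi / real n)" using assms by (intro cos_gt_zero) auto
  have "pi / real n \<le> pi" using assms by (simp add: divide_le_eq)
  then show "cos (pi / real n) < 1"
    using assms cos_monotone_0_pi[of 0 "pi / real n"] by simp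
qed

lemma sym_add_scale_id:
  "s \<in> coords G \<Longrightarrow> sym_add G M (sym_scale G c (sym_id G)) s = M s + c * (case s of Inl i \<Rightarrow> 1 | Inr e \<Rightarrow> 0)"
  by (simp add: sym_add_def sym_scale_def sym_id_def)

lemma sym_add_in_Sym: "sym_add G A B \<in> Sym G"
  by (simp add: sym_add_def Sym_def)

lemma cycle_coords:
  assumes "i \<in> {1..n}"
  shows "Inl i \<in> coords (cycle_graph n)" "Inr {i, cyc_next n i} \<in> coords (cycle_graph n)"
  using assms unfolding coords_def cycle_graph_def cyc_next_def by auto

lemma shifted_cycle_completable_iff:
  assumes "n > 2"
  shows "sym_add (cycle_graph n) M (sym_scale (cycle_graph n) c (sym_id (cycle_graph n)))
      \<in> psd_completable (cycle_graph n) \<longleftrightarrow>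
    cycle_completable n (\<lambda>i. M (Inl i) + c) (\<lambda>i. M (Inr {i, cyc_next n i}))"
proof -
  let ?A = "sym_add (cycle_graph n) M (sym_scale (cycle_graph n) c (sym_id (cycle_graph n)))"
  have "?A (Inl i) = M (Inl i) + c" "?A (Inr {i, cyc_next n i}) = M (Inr {i, cyc_next n i})"
    if "i \<in> {1..n}" for i
    using cycle_coords[OF that] by (simp_all add: sym_add_scale_id)
  then show ?thesis
    unfolding psd_completable_cycle_iff[OF assms sym_add_in_Sym]
    by (auto elim!: cycle_completable_cong)
qed

lemma cycle_shift_sufficient:
  assumes n: "n > 3" and M: "M \<in> clique_psd_normalized (cycle_graph n)"
  defines "e \<equiv> 1 / real n * (1 / cos (pi / real n) - 1)"
  shows "cycle_completable n (\<lambda>i. M (Inl i) + e) (\<lambda>i. M (Inr {i, cyc_next n i}))"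
proof -
  note c = cos_pi_over_nat[of n]
  define x where "x i = sqrt (M (Inl i))" for i
  have edge: "M (Inl i) \<ge> 0 \<and> \<bar>M (Inr {i, cyc_next n i})\<bar> \<le> x i * x (cyc_next n i)"
    if i: "i \<in> {1..n}" for i
  proof -
    have "psd_on {i, cyc_next n i} (entry M)"
      using M cycle_edge_maximal_clique[OF n i]
      unfolding clique_psd_normalized_def clique_psd_def by blast
    moreover have "i \<noteq> cyc_next n i" using i n by (auto simp: cyc_next_eq)
    ultimately show ?thesis using psd_on_pair[of i "cyc_next n i" "entry M"]
      by (simp add: entry_def x_def)
  qed
  have x2: "(x i)\<^sup>2 = M (Inl i)" if "i \<in> {1..n}" for i
    using edge[OF that] by (simp add: x_def)
  have "sym_trace (cycle_graph n) M = 1"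
    using M unfolding clique_psd_normalized_def by simp
  then have sum: "(\<Sum>i=1..n. (x i)\<^sup>2) = 1"
    using x2 by (simp add: sym_trace_def entry_def cycle_graph_def)
  have "1 / cos (pi / real n) > 1" using c n by simp
  then have e: "e > 0" using n by (simp add: e_def)
  \<comment> \<open>This equation determines \<open>e\<close>: it makes the Jensen bound exactly
    \<open>n\<close> times \<open>pi / n\<close>.\<close>
  have "1 + real n * e = 1 / cos (pi / real n)" using n by (simp add: e_def)
  then have "real n * arccos (1 / (1 + real n * e)) = pi"
    using n by (simp add: arccos_cos divide_le_eq)
  then have "pi \<le> (\<Sum>i=1..n. edge_angle (x i) (x (cyc_next n i)) e)"
    using edge_angle_sum_ge[of n e x] n e sum edge by (simp add: x_def)
  then have "cycle_completable n (\<lambda>i. (x i)\<^sup>2 + e) (\<lambda>i. M (Inr {i, cyc_next n i}))"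
    using n e edge by (intro cycle_completable_of_angle_sum) (auto simp: x_def)
  then show ?thesis by (rule cycle_completable_cong) (use x2 in auto)
qed

section \<open>Lower bound: the certificate and the extremal matrix\<close>

text \<open>The weighted sum of the squares of \<open>sin t x\<^sub>n - sin ((i + 1) t) x\<^sub>i + sin (i t) x\<^sub>i\<^sub>+\<^sub>1\<close> with
  weights \<open>1 / (sin (i t) sin ((i + 1) t))\<close>, where \<open>t = \<pi> / n\<close> and \<open>1 \<le> i \<le> n - 2\<close>, is the quadratic
  form of \<open>2 cos t\<close> times the identity minus the signed adjacency matrix of the cycle: the entries
  on the chords cancel. Below this cancellation is a telescoping sum.\<close>

lemma odd_cycle_completable_necessary:
  assumes n: "n > 2"
    and comp: "cycle_completable n (\<lambda>_. d) (\<lambda>i. if i = n - 1 then - b else b)"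
  shows "b \<le> d * cos (pi / real n)"
proof -
  obtain X where X: "psd_on {1..n} X" "\<And>i. i \<in> {1..n} \<Longrightarrow> X i i = d"
    "\<And>i. i \<in> {1..n} \<Longrightarrow> X i (cyc_next n i) = (if i = n - 1 then - b else b)"
    using comp unfolding cycle_completable_def by blast
  define t where "t = pi / real n"
  define s where "s i = sin (real i * t)" for i
  define C where "C i = cos (real i * t)" for i
  \<comment> \<open>The potential of the telescoping sum: the chord entry \<open>X n i\<close> with
    a cotangent correction. The latter absorbs the diagonal terms, as
    \<open>C i / s i - C (Suc i) / s (Suc i) = s 1 / (s i * s (Suc i))\<close>.\<close>
  define g where "g i = s 1 * (X n i / s i - d * (C i / s i))" for i
  have s_pos: "s i > 0" if "1 \<le> i" "i < n" for i
    unfolding s_def t_def using that by (intro sin_gt_zero) (auto simp: field_simps)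
  have step: "g i - (d * C 1 - b) \<le> g (Suc i)" if i: "1 \<le> i" "i \<le> n - 2" for i
  proof -
    have pos: "s i > 0" "s (Suc i) > 0" using i n by (auto intro!: s_pos)
    have "i \<in> {1..n}" "i \<noteq> n" "i \<noteq> n - 1" using i n by auto
    then have b: "X i (Suc i) = b" using X(3)[of i] by (simp add: cyc_next_eq)
    have "psd_on {n, i, Suc i} X" using X(1) i n by (elim psd_on_subset) auto
    \<comment> \<open>These coefficients are the linear relation between plane unit vectors at
      angles 0, \<open>i * t\<close> and \<open>(i + 1) * t\<close>. Such vectors, scaled to equal
      length, represent \<open>n\<close>, \<open>i\<close>, \<open>Suc i\<close> in the extremal
      completion, so the inequality is tight there.\<close>
    from psd_on_triple[OF this, of "s 1" "- s (Suc i)" "s i"]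
    have form: "0 \<le> d * ((s 1)\<^sup>2 + (s (Suc i))\<^sup>2 + (s i)\<^sup>2)
        - 2 * s 1 * s (Suc i) * X n i + 2 * s 1 * s i * X n (Suc i) - 2 * s i * s (Suc i) * b"
      using i n X(2)[of i] X(2)[of n] X(2)[of "Suc i"] b by (auto simp: algebra_simps)
    have add: "s (Suc i) = s i * C 1 + C i * s 1" "C (Suc i) = C i * C 1 - s i * s 1"
      by (simp_all add: s_def C_def ring_distribs sin_add cos_add)
    have pyth: "(C i)\<^sup>2 = 1 - (s i)\<^sup>2" "(C 1)\<^sup>2 = 1 - (s 1)\<^sup>2"
      by (simp_all add: s_def C_def cos_squared_eq)
    have "(s (Suc i))\<^sup>2 + (s i)\<^sup>2 = (s 1)\<^sup>2 + 2 * C 1 * s i * s (Suc i)"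
      using pyth unfolding add by algebra
    moreover have "C i * s (Suc i) - C (Suc i) * s i = s 1"
      using pyth unfolding add by algebra
    ultimately have "(s 1)\<^sup>2 + (s (Suc i))\<^sup>2 + (s i)\<^sup>2
        = 2 * (s 1 * (C i * s (Suc i) - C (Suc i) * s i) + C 1 * s i * s (Suc i))"
      by (simp only: power2_eq_square) algebra
    with form have "0 \<le> 2 * (d * (s 1 * (C i * s (Suc i) - C (Suc i) * s i) + C 1 * s i * s (Suc i))
        - s 1 * s (Suc i) * X n i + s 1 * s i * X n (Suc i) - s i * s (Suc i) * b)"
      by (simp only:) (simp add: algebra_simps)
    also have "\<dots> = 2 * (s i * s (Suc i)) * (g (Suc i) - g i + (d * C 1 - b))"
      unfolding g_def using pos by (simp add: field_simps)
    finally show ?thesis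
      using mult_pos_pos[OF pos] by (auto simp: zero_le_mult_iff)
  qed
  have "g 1 - real k * (d * C 1 - b) \<le> g (Suc k)" if "k \<le> n - 2" for k
    using that
  proof (induction k)
    case (Suc k)
    then show ?case using step[of "Suc k"] by (simp add: algebra_simps)
  qed simp
  from this[of "n - 2"] have "g 1 - real (n - 2) * (d * C 1 - b) \<le> g (n - 1)"
    using n by (simp add: Suc_diff_Suc numeral_2_eq_2)
  \<comment> \<open>At \<open>1\<close> and \<open>n - 1\<close> the chord from \<open>n\<close> is
    an edge of the cycle, so both end values of \<open>g\<close> are known.\<close>
  moreover have "g 1 = b - d * C 1"
    using X(3)[of n] n s_pos[of 1] by (simp add: g_def cyc_next_eq field_simps)
  moreover have "g (n - 1) = - b + d * C 1"
  proof -
    have "real (n - 1) * t = pi - t" using n by (simp add: t_def of_nat_diff field_simps)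
    then have "s (n - 1) = s 1" "C (n - 1) = - C 1" by (simp_all add: s_def C_def sin_diff cos_diff)
    moreover have "X n (n - 1) = - b"
    proof -
      have mem: "n - 1 \<in> {1..n}" "n \<in> {1..n}" using n by auto
      then have "cyc_next n (n - 1) = n" using n by (simp add: cyc_next_eq)
      then show ?thesis using X(3)[OF mem(1)] psd_on_sym[OF X(1) mem] by simp
    qed
    ultimately show ?thesis using s_pos[of 1] n by (simp add: g_def field_simps)
  qed
  moreover have "real (n - 2) = real n - 2" using n by (simp add: of_nat_diff)
  \<comment> \<open>The \<open>n - 2\<close> triangles and the two end values each contribute one
    copy of \<open>d * C 1 - b\<close>, hence \<open>n\<close> copies in all.\<close>
  ultimately have "b - d * C 1 - (real n - 2) * (d * C 1 - b) \<le> - b + d * C 1" by (simp only:)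
  then have "0 \<le> real n * (d * C 1 - b)" by (simp add: algebra_simps)
  then have "b \<le> d * C 1" using n by (simp add: zero_le_mult_iff)
  then show ?thesis by (simp add: C_def t_def)
qed

text \<open>Every edge block has rank one, but the signs around the cycle multiply to -1. The
  negative edge is the one entering \<open>n\<close>, since the certificate places \<open>n\<close>,
  1 and \<open>n - 1\<close> at the angles 0, \<open>t\<close> and \<open>pi - t\<close>.\<close>

definition odd_cycle_matrix :: "nat \<Rightarrow> nat + nat set \<Rightarrow> real" where
  "odd_cycle_matrix n = (\<lambda>s\<in>coords (cycle_graph n).
     case s of Inl i \<Rightarrow> 1 / real n | Inr e \<Rightarrow> if e = {n - 1, n} then - (1 / real n) else 1 / real n)"

lemma odd_cycle_matrix_entries:
  assumes "n > 2" "i \<in> {1..n}"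
  shows "odd_cycle_matrix n (Inl i) = 1 / real n"
    "odd_cycle_matrix n (Inr {i, cyc_next n i}) = (if i = n - 1 then - (1 / real n) else 1 / real n)"
proof -
  show "odd_cycle_matrix n (Inl i) = 1 / real n"
    using cycle_coords[OF assms(2)] by (simp add: odd_cycle_matrix_def)
  have "{i, cyc_next n i} = {n - 1, n} \<longleftrightarrow> i = n - 1"
    using assms by (auto simp: doubleton_eq_iff cyc_next_eq)
  then show "odd_cycle_matrix n (Inr {i, cyc_next n i}) = (if i = n - 1 then - (1 / real n) else 1 / real n)"
    using cycle_coords[OF assms(2)] by (simp add: odd_cycle_matrix_def)
qed

lemma odd_cycle_matrix_normalized:
  assumes n: "n > 3"
  shows "odd_cycle_matrix n \<in> clique_psd_normalized (cycle_graph n)"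
proof -
  let ?M = "odd_cycle_matrix n"
  have "psd_on K (entry ?M)" if K: "clique (cycle_graph n) K" for K
  proof -
    obtain i where i: "i \<in> {1..n}" "K \<subseteq> {i, cyc_next n i}"
      using cycle_clique_cases[OF n K] by blast
    \<comment> \<open>The sign of the edge containing the clique: its block is
      \<open>1 / real n\<close> times the Gram matrix of the vector with entries 1 and
      \<open>c\<close>.\<close>
    define c :: real where "c = (if i = n - 1 then - 1 else 1)"
    let ?u = "\<lambda>j. if j = i then 1 else c"
    have ne: "i \<noteq> cyc_next n i" using i n by (auto simp: cyc_next_eq)
    have M: "?M (Inl i) = 1 / real n" "?M (Inl (cyc_next n i)) = 1 / real n"
      "?M (Inr {i, cyc_next n i}) = 1 / real n * c" "?M (Inr {cyc_next n i, i}) = 1 / real n * c"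
      using odd_cycle_matrix_entries[of n i] odd_cycle_matrix_entries(1)[of n "cyc_next n i"]
        cyc_next_in[OF i(1)] i(1) n by (auto simp: c_def insert_commute)
    have "entry ?M j k = 1 / real n * (?u j * ?u k)" if "j \<in> {i, cyc_next n i}" "k \<in> {i, cyc_next n i}" for j k
      using that ne M by (auto simp: entry_def c_def)
    moreover have "psd_on {i, cyc_next n i} (\<lambda>j k. 1 / real n * (?u j * ?u k))"
      by (intro psd_on_scale psd_on_gram) simp
    ultimately have "psd_on {i, cyc_next n i} (entry ?M)"
      by (subst psd_on_cong) auto
    then show ?thesis using i(2) by (rule psd_on_subset) simp
  qed
  moreover have "sym_trace (cycle_graph n) ?M = 1"
    using odd_cycle_matrix_entries(1)[of n] n by (simp add: sym_trace_def entry_def cycle_graph_def)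
  moreover have "?M \<in> Sym (cycle_graph n)" by (simp add: odd_cycle_matrix_def Sym_def)
  ultimately show ?thesis
    unfolding clique_psd_normalized_def clique_psd_def maximal_clique_def by blast
qed

theorem theorem18:
  fixes n :: nat
  assumes "n > 3"
  shows "conical_distance (cycle_graph n) = 1 / real n * (1 / cos (pi / real n) - 1)"
  unfolding conical_distance_def
proof (rule Least_equality)
  show "\<forall>M\<in>clique_psd_normalized (cycle_graph n).
      sym_add (cycle_graph n) M (sym_scale (cycle_graph n) (1 / real n * (1 / cos (pi / real n) - 1))
        (sym_id (cycle_graph n))) \<in> psd_completable (cycle_graph n)"
    using assms cycle_shift_sufficient by (simp add: shifted_cycle_completable_iff)
next
  fix y assume y: "\<forall>M\<in>clique_psd_normalized (cycle_graph n).
      sym_add (cycle_graph n) M (sym_scale (cycle_graph n) y (sym_id (cycle_graph n)))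
        \<in> psd_completable (cycle_graph n)"
  let ?M = "odd_cycle_matrix n"
  have "cycle_completable n (\<lambda>i. ?M (Inl i) + y) (\<lambda>i. ?M (Inr {i, cyc_next n i}))"
    using y assms odd_cycle_matrix_normalized shifted_cycle_completable_iff[of n] by auto
  then have "cycle_completable n (\<lambda>_. 1 / real n + y) (\<lambda>i. if i = n - 1 then - (1 / real n) else 1 / real n)"
    by (rule cycle_completable_cong) (use assms odd_cycle_matrix_entries[of n] in auto)
  then have "1 / real n \<le> (1 / real n + y) * cos (pi / real n)"
    using assms by (intro odd_cycle_completable_necessary) auto
  then have "1 / real n / cos (pi / real n) \<le> 1 / real n + y"
    using cos_pi_over_nat(1)[of n] assms by (simp only: pos_divide_le_eq)
  then show "1 / real n * (1 / cos (pi / real n) - 1) \<le> y" by (simp add: algebra_simps)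
qed

end
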